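(* Let $E$ be a nonempty locally compact Borel space, $P(x,dy)$ a transition probability function on $E$, $\nu$ a probability measure on $\mathcal{B}(E)$, $p\in(0,1)$, and $H\in\mathcal{B}(E)$. Let $\tilde X$ be the Markov chain on $E$ with transition probability function $\tilde P(x,\Gamma)=p\,\nu(\Gamma)+(1-p)P(x,\Gamma)$, let $q$ be its unique invariant probability measure, and let $V(x):=E_x[\eta_H]$, where $\eta_H:=\inf\{t=0,1,\dots:\tilde X_t\in H\}$. Then the following statements are equivalent. (a) $q(H)>0$. (b) $V(x)=E_x[\eta_H]<\infty$ for each $x\in E$. (c) $V(x)=E_x[\eta_H]<\infty$ for almost all $x\in E$ with respect to $q(dy)$. (d) $\sup_{x\in E}V(x)=\sup_{x\in E}E_x[\eta_H]<\infty$.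
   Context: $E_x$ denotes expectation when the chain starts at $x$; $\inf\emptyset:=\infty$. The powers of $P$ are $P^0(x,\Gamma):=I\{x\in\Gamma\}$, $P^{t+1}(x,\Gamma):=\int_E P^t(x,dy)P(y,\Gamma)$. The unique invariant probability measure of $\tilde X$ is given by $$q(\Gamma)=\int_E \sum_{t=0}^\infty p(1-p)^t P^t(y,\Gamma)\,\nu(dy),\qquad \Gamma\in\mathcal{B}(E).$$ *)

theory Defs
  imports "HOL-Probability.Probability"
begin

abbreviation borel_on :: "'a::topological_space set \<Rightarrow> 'a measure" where
  "borel_on E \<equiv> restrict_space borel E"

text \<open>
  A transition probability function on a measurable space \<open>M\<close> is a Markov kernel, i.e. a
  measurable map from \<open>M\<close> to \<open>prob_algebra M\<close>; its values outside \<open>space M\<close> are irrelevant.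
\<close>

abbreviation transition_prob :: "'a measure \<Rightarrow> ('a \<Rightarrow> 'a measure) \<Rightarrow> bool" where
  "transition_prob M P \<equiv> P \<in> M \<rightarrow>\<^sub>M prob_algebra M"

definition restart_kernel ::
  "'a measure \<Rightarrow> real \<Rightarrow> 'a measure \<Rightarrow> ('a \<Rightarrow> 'a measure) \<Rightarrow> 'a \<Rightarrow> 'a measure" where
  "restart_kernel M p \<nu> P x =
     measure_of (space M) (sets M)
       (\<lambda>\<Gamma>. ennreal p * emeasure \<nu> \<Gamma> + ennreal (1 - p) * emeasure (P x) \<Gamma>)"

definition invariant_prob_measure :: "'a measure \<Rightarrow> ('a \<Rightarrow> 'a measure) \<Rightarrow> 'a measure \<Rightarrow> bool" where
  "invariant_prob_measure M K q \<longleftrightarrow>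
     prob_space q \<and> sets q = sets M \<and>
     (\<forall>\<Gamma>\<in>sets M. emeasure q \<Gamma> = (\<integral>\<^sup>+x. emeasure (K x) \<Gamma> \<partial>q))"

text \<open>
  The law on the path space \<open>E\<^sup>\<nat>\<close> of the canonical chain with transition function \<open>K\<close> started
  at \<open>x\<close>, by the Ionescu-Tulcea theorem.  The library indexes its kernels so that the \<open>n\<close>-th
  one is the conditional law of coordinate \<open>n\<close> given coordinates \<open>0, ..., n - 1\<close>; the \<open>0\<close>-th one
  is thus the initial distribution.
\<close>

definition chain_kernel ::
  "'a measure \<Rightarrow> ('a \<Rightarrow> 'a measure) \<Rightarrow> 'a \<Rightarrow> nat \<Rightarrow> (nat \<Rightarrow> 'a) \<Rightarrow> 'a measure" where
  "chain_kernel M K x n \<omega> = (case n of 0 \<Rightarrow> return M x | Suc m \<Rightarrow> K (\<omega> m))"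

definition chain_law :: "'a measure \<Rightarrow> ('a \<Rightarrow> 'a measure) \<Rightarrow> 'a \<Rightarrow> (nat \<Rightarrow> 'a) measure" where
  "chain_law M K x =
     projective_family.lim UNIV (Ionescu_Tulcea.CI (chain_kernel M K x) (\<lambda>_. M)) (\<lambda>_. M)"

text \<open>The infimum is taken in the complete lattice \<open>ennreal\<close>, so it is \<open>\<infinity>\<close> for the empty set.\<close>

definition hitting_time :: "'a set \<Rightarrow> (nat \<Rightarrow> 'a) \<Rightarrow> ennreal" where
  "hitting_time H \<omega> = Inf {of_nat t | t. \<omega> t \<in> H}"

definition mean_hitting_time ::
  "'a measure \<Rightarrow> ('a \<Rightarrow> 'a measure) \<Rightarrow> 'a set \<Rightarrow> 'a \<Rightarrow> ennreal" where
  "mean_hitting_time M K H x = (\<integral>\<^sup>+\<omega>. hitting_time H \<omega> \<partial>chain_law M K x)"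

text \<open>
  The remaining facts show that the constructions above are not vacuous: the weighted sum in
  \<open>restart_kernel\<close> is a probability measure and a Markov kernel, \<open>chain_law\<close> satisfies the
  hypotheses of the Ionescu-Tulcea theorem, and \<open>hitting_time\<close> is measurable.
\<close>

lemma space_restart_kernel [simp]: "space (restart_kernel M p \<nu> P x) = space M"
  by (simp add: restart_kernel_def)

lemma sets_restart_kernel [simp]: "sets (restart_kernel M p \<nu> P x) = sets M"
  by (simp add: restart_kernel_def)

lemma emeasure_restart_kernel:
  assumes "sets \<nu> = sets M" "transition_prob M P" "x \<in> space M" "\<Gamma> \<in> sets M"
  shows "emeasure (restart_kernel M p \<nu> P x) \<Gamma> =
           ennreal p * emeasure \<nu> \<Gamma> + ennreal (1 - p) * emeasure (P x) \<Gamma>"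
proof -
  have sP: "sets (P x) = sets M"
    using measurable_space[OF assms(2,3)] by (simp add: space_prob_algebra)
  show ?thesis
  proof (rule emeasure_measure_of[OF restart_kernel_def])
    show "countably_additive (sets (restart_kernel M p \<nu> P x))
        (\<lambda>\<Gamma>. ennreal p * emeasure \<nu> \<Gamma> + ennreal (1 - p) * emeasure (P x) \<Gamma>)"
    proof (rule countably_additiveI)
      fix A :: "nat \<Rightarrow> 'a set"
      assume A: "range A \<subseteq> sets (restart_kernel M p \<nu> P x)" and d: "disjoint_family A"
      have "(\<Sum>i. emeasure \<nu> (A i)) = emeasure \<nu> (\<Union>i. A i)"
           "(\<Sum>i. emeasure (P x) (A i)) = emeasure (P x) (\<Union>i. A i)"
        using A d assms(1) sP by (auto intro!: suminf_emeasure)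
      then show "(\<Sum>i. ennreal p * emeasure \<nu> (A i) + ennreal (1 - p) * emeasure (P x) (A i)) =
          ennreal p * emeasure \<nu> (\<Union>i. A i) + ennreal (1 - p) * emeasure (P x) (\<Union>i. A i)"
        by (simp add: suminf_add[symmetric])
    qed
  qed (use assms(4) sets.sets_into_space in \<open>auto simp: positive_def\<close>)
qed

lemma transition_prob_restart_kernel:
  assumes "prob_space \<nu>" "sets \<nu> = sets M" "transition_prob M P" "0 < p" "p < 1"
  shows "transition_prob M (restart_kernel M p \<nu> P)"
proof (rule measurable_prob_algebraI)
  have pr: "prob_space (restart_kernel M p \<nu> P x)" if x: "x \<in> space M" for x
  proof
    have P: "prob_space (P x)" "sets (P x) = sets M"
      using measurable_space[OF assms(3) x] by (auto simp: space_prob_algebra)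
    have "emeasure \<nu> (space M) = 1" "emeasure (P x) (space M) = 1"
      using prob_space.emeasure_space_1[OF assms(1)] prob_space.emeasure_space_1[OF P(1)]
        sets_eq_imp_space_eq[OF assms(2)] sets_eq_imp_space_eq[OF P(2)] by simp_all
    then show "emeasure (restart_kernel M p \<nu> P x) (space (restart_kernel M p \<nu> P x)) = 1"
      using assms(4,5) emeasure_restart_kernel[OF assms(2,3) x sets.top]
      by (simp flip: ennreal_plus)
  qed
  then show "prob_space (restart_kernel M p \<nu> P x)" if "x \<in> space M" for x
    using that .
  show "restart_kernel M p \<nu> P \<in> M \<rightarrow>\<^sub>M subprob_algebra M"
  proof (rule measurable_subprob_algebra)
    fix \<Gamma> assume G: "\<Gamma> \<in> sets M"
    have [measurable]: "(\<lambda>x. emeasure (P x) \<Gamma>) \<in> borel_measurable M"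
      using measurable_emeasure_kernel[OF measurable_prob_algebraD[OF assms(3)] G] .
    have "(\<lambda>x. ennreal p * emeasure \<nu> \<Gamma> + ennreal (1 - p) * emeasure (P x) \<Gamma>)
        \<in> borel_measurable M"
      by measurable
    then show "(\<lambda>x. emeasure (restart_kernel M p \<nu> P x) \<Gamma>) \<in> borel_measurable M"
      by (subst measurable_cong[OF emeasure_restart_kernel[OF assms(2,3) _ G]])
  qed (use pr in \<open>auto intro: prob_space_imp_subprob_space\<close>)
qed

lemma Ionescu_Tulcea_chain_kernel:
  assumes "transition_prob M K" "x \<in> space M"
  shows "Ionescu_Tulcea (chain_kernel M K x) (\<lambda>_. M)"
proof (rule Ionescu_Tulcea.intro)
  show "chain_kernel M K x i \<in> PiM {0..<i} (\<lambda>_. M) \<rightarrow>\<^sub>M subprob_algebra M" for i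
  proof (cases i)
    case 0
    have "return M x \<in> space (subprob_algebra M)"
      using assms(2) by (auto simp: space_subprob_algebra subprob_space_return)
    then show ?thesis
      by (simp add: chain_kernel_def[abs_def] 0)
  next
    case (Suc m)
    have [measurable]: "K \<in> M \<rightarrow>\<^sub>M subprob_algebra M"
      using assms(1) by (rule measurable_prob_algebraD)
    have "(\<lambda>\<omega>. K (\<omega> m)) \<in> PiM {0..<Suc m} (\<lambda>_. M) \<rightarrow>\<^sub>M subprob_algebra M"
      by measurable
    then show ?thesis
      by (simp add: chain_kernel_def[abs_def] Suc)
  qed
next
  show "prob_space (chain_kernel M K x i \<omega>)"
    if w: "\<omega> \<in> space (PiM {0..<i} (\<lambda>_. M))" for i \<omega>
  proof (cases i)
    case 0
    with assms(2) show ?thesis by (simp add: chain_kernel_def prob_space_return)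
  next
    case (Suc m)
    with w have "\<omega> m \<in> space M" by (auto simp: space_PiM PiE_iff)
    from measurable_space[OF assms(1) this] show ?thesis
      by (simp add: chain_kernel_def Suc space_prob_algebra)
  qed
qed

lemma prob_space_chain_law:
  assumes "transition_prob M K" "x \<in> space M"
  shows "prob_space (chain_law M K x)"
proof -
  interpret Ionescu_Tulcea "chain_kernel M K x" "\<lambda>_. M"
    using assms by (rule Ionescu_Tulcea_chain_kernel)
  interpret lim: prob_space PF.lim
  proof
    have "emeasure PF.lim (PF.emb UNIV {} (space (PiM {} (\<lambda>_. M)))) = emeasure (CI {}) (space (PiM {} (\<lambda>_. M)))"
      by (rule lim) auto
    also have "\<dots> = 1"
      using prob_space.emeasure_space_1[OF PF.prob_space_P[of "{}"]] by (simp add: PF.space_P)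
    also have "PF.emb UNIV {} (space (PiM {} (\<lambda>_. M))) = space PF.lim"
      by (auto simp: prod_emb_def space_PiM)
    finally show "emeasure PF.lim (space PF.lim) = 1" .
  qed
  show ?thesis
    unfolding chain_law_def by (rule lim.prob_space_axioms)
qed

lemma hitting_time_measurable:
  assumes [measurable]: "H \<in> sets M"
  shows "hitting_time H \<in> borel_measurable (PiM UNIV (\<lambda>_. M))"
proof -
  have "hitting_time H = (\<lambda>\<omega>. INF t. if \<omega> t \<in> H then of_nat t else \<infinity>)"
  proof
    fix \<omega> :: "nat \<Rightarrow> 'a"
    show "hitting_time H \<omega> = (INF t. if \<omega> t \<in> H then of_nat t else \<infinity>)"
      unfolding hitting_time_def
      by (intro antisym Inf_greatest INF_greatest)
         (auto intro: Inf_lower INF_lower2)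
  qed
  moreover have "(\<lambda>\<omega>. INF t. if \<omega> t \<in> H then of_nat t else (\<infinity>::ennreal))
      \<in> borel_measurable (PiM UNIV (\<lambda>_. M))"
    by measurable
  ultimately show ?thesis by (simp only:)
qed

end

theory Submission
  imports Defs
begin

text \<open>
  Let \<open>G\<close> be the complement of \<open>H\<close> and let \<open>s\<^sub>n(x)\<close> be the probability that the chain
  started at \<open>x\<close> is in \<open>G\<close> at times \<open>1, ..., n\<close>; then \<open>V\<close> is the sum over \<open>n\<close> of
  \<open>1\<^sub>G s\<^sub>n\<close>.  If \<open>H\<close> is \<open>q\<close>-null, invariance gives \<open>s\<^sub>n = 1\<close> almost everywhere, hence
  \<open>V = \<infinity>\<close> almost everywhere.  Conversely, if the chain started from \<open>\<nu>\<close> meets \<open>H\<close> by some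
  time \<open>n\<close> with positive probability, the restarts make \<open>s\<close> at time \<open>n + 1\<close> uniformly smaller
  than \<open>1\<close>, and \<open>s\<close> decays geometrically.  Otherwise the set of points from which \<open>H\<close> is
  never reached has full \<open>\<nu>\<close>-measure and is absorbing; as it is entered with probability at
  least \<open>p\<close> from everywhere, it carries all of \<open>q\<close>, so that \<open>H\<close> is \<open>q\<close>-null.
\<close>

text \<open>The time \<open>0\<close> is not included: the starting point itself may lie outside \<open>G\<close>.\<close>

primrec stay_prob :: "('a \<Rightarrow> 'a measure) \<Rightarrow> 'a set \<Rightarrow> nat \<Rightarrow> 'a \<Rightarrow> ennreal" where
  "stay_prob K G 0 x = 1"
| "stay_prob K G (Suc n) x = (\<integral>\<^sup>+y. indicator G y * stay_prob K G n y \<partial>K x)"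

section \<open>Series in \<open>ennreal\<close> and the tail-sum formula for hitting times\<close>

text \<open>Splitting a partial sum after \<open>N\<close> terms leaves a tail that is at most
  \<open>d\<close> times a shorter partial sum. The bound is the fixed point of
  \<open>c = N + d * c\<close>, so it propagates by strong induction on the length; working with
  partial sums avoids subtracting a possibly infinite total.\<close>

lemma suminf_ennreal_le_of_shift_contraction:
  fixes f :: "nat \<Rightarrow> ennreal"
  assumes "\<And>n. f n \<le> 1" and "\<And>n. f (n + N) \<le> ennreal d * f n" and "0 \<le> d" "d < 1" and N: "0 < N"
  shows "(\<Sum>n. f n) \<le> ennreal (real N / (1 - d))"
proof (rule suminf_le_const[OF summableI])
  define c where "c = ennreal (real N / (1 - d))"
  have c: "of_nat N + ennreal d * c = c"
    using assms(3,4)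
    by (simp add: c_def ennreal_of_nat_eq_real_of_nat field_simps flip: ennreal_mult ennreal_plus)
  have head: "(\<Sum>k<N. f k) \<le> of_nat N"
    using sum_mono[of "{..<N}" f "\<lambda>_. 1"] assms(1) by simp
  show "(\<Sum>k<n. f k) \<le> c" for n
  proof (induction n rule: less_induct)
    case (less n)
    have "(\<Sum>k<n. f k) \<le> of_nat N + ennreal d * c"
    proof (cases "n \<le> N")
      case True
      then have "(\<Sum>k<n. f k) \<le> (\<Sum>k<N. f k)"
        by (intro sum_mono2) auto
      with head show ?thesis
        by (meson add_increasing2 order_trans zero_le)
    next
      case False
      have "(\<Sum>k<n. f k) = (\<Sum>k<N. f k) + (\<Sum>k<n-N. f (k + N))"
        using \<open>\<not> n \<le> N\<close>
          sum.atLeastLessThan_concat[of 0 N n f] sum.shift_bounds_nat_ivl[of f 0 N "n - N"]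
        by (simp add: atLeast0LessThan add.commute)
      also have "(\<Sum>k<n-N. f (k + N)) \<le> ennreal d * (\<Sum>k<n-N. f k)"
        using assms(2) by (simp add: sum_distrib_left sum_mono)
      also have "(\<Sum>k<n-N. f k) \<le> c"
        using \<open>\<not> n \<le> N\<close> N by (intro less) auto
      finally show ?thesis
        using head by (meson add_mono dual_order.trans mult_left_mono order_refl zero_le add_left_mono)
    qed
    with c show ?case by simp
  qed
qed

lemma suminf_one_ennreal: "(\<Sum>n::nat. 1 :: ennreal) = \<top>"
proof -
  have "(SUP n. of_nat n :: ennreal) \<le> (\<Sum>n::nat. 1)"
    using sum_le_suminf[OF summableI, of "{..<n}" "\<lambda>_. 1 :: ennreal" for n]
    by (intro SUP_least) simp
  then show ?thesis
    by (simp add: ennreal_SUP_of_nat_eq_top top_unique)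
qed

text \<open>Tail-sum formula: the \<open>n\<close>-th product is the indicator of the event that the
  hitting time exceeds \<open>n\<close>. If \<open>H\<close> is never visited, every summand is 1
  and both sides are infinite.\<close>

lemma hitting_time_eq_suminf:
  "hitting_time H \<omega> = (\<Sum>n. \<Prod>i\<le>n. indicator (- H) (\<omega> i))"
proof -
  have prod: "(\<Prod>i\<le>n. indicator (- H) (\<omega> i)) = (if \<forall>i\<le>n. \<omega> i \<notin> H then 1 else 0 :: ennreal)" for n
    by (auto simp: prod_zero_iff indicator_def intro!: prod.neutral)
  show ?thesis
  proof (cases "\<exists>t. \<omega> t \<in> H")
    case True
    define t where "t = (LEAST t. \<omega> t \<in> H)"
    have t: "\<omega> t \<in> H" "\<And>i. \<omega> i \<in> H \<Longrightarrow> t \<le> i"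
      unfolding t_def using True by (auto intro: LeastI Least_le)
    have "hitting_time H \<omega> = of_nat t"
      unfolding hitting_time_def using t by (intro antisym Inf_greatest Inf_lower) auto
    moreover have "(\<forall>i\<le>n. \<omega> i \<notin> H) \<longleftrightarrow> n < t" for n
      using t by (meson leD le_less_linear order_trans)
    then have "(\<Sum>n. \<Prod>i\<le>n. indicator (- H) (\<omega> i)) = (\<Sum>n. if n < t then 1 else 0 :: ennreal)"
      unfolding prod by simp
    moreover have "\<dots> = (\<Sum>n<t. if n < t then 1 else 0)"
      by (intro suminf_finite) auto
    ultimately show ?thesis by simp
  next
    case False
    then have "hitting_time H \<omega> = \<top>"
      by (simp add: hitting_time_def)
    moreover have "(\<Sum>n. \<Prod>i\<le>n. indicator (- H) (\<omega> i)) = (\<Sum>n::nat. 1 :: ennreal)"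
      unfolding prod using False by simp
    ultimately show ?thesis
      by (simp only: suminf_one_ennreal)
  qed
qed

section \<open>Markov kernels and stay probabilities\<close>

lemma prob_space_kernel: "transition_prob M K \<Longrightarrow> x \<in> space M \<Longrightarrow> prob_space (K x)"
  using measurable_space[of K M "prob_algebra M" x] by (simp add: space_prob_algebra)

lemma sets_kernel: "transition_prob M K \<Longrightarrow> x \<in> space M \<Longrightarrow> sets (K x) = sets M"
  using measurable_space[of K M "prob_algebra M" x] by (simp add: space_prob_algebra)

lemma space_kernel: "transition_prob M K \<Longrightarrow> x \<in> space M \<Longrightarrow> space (K x) = space M"
  by (intro sets_eq_imp_space_eq sets_kernel)

context
  fixes M :: "'a measure" and K :: "'a \<Rightarrow> 'a measure" and G :: "'a set"
  assumes K: "transition_prob M K" and G[measurable]: "G \<in> sets M"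
begin

lemma measurable_stay_prob [measurable]: "stay_prob K G n \<in> borel_measurable M"
proof (induction n)
  case (Suc n)
  note [measurable] = Suc measurable_prob_algebraD[OF K]
  have "(\<lambda>x. \<integral>\<^sup>+y. indicator G y * stay_prob K G n y \<partial>K x) \<in> borel_measurable M"
    by (rule measurable_compose[OF measurable_prob_algebraD[OF K]
          nn_integral_measurable_subprob_algebra]) measurable
  then show ?case by (simp add: fun_eq_iff cong: measurable_cong)
qed simp

lemma stay_prob_le_1: "x \<in> space M \<Longrightarrow> stay_prob K G n x \<le> 1"
proof (induction n arbitrary: x)
  case (Suc n)
  interpret prob_space "K x" using K Suc.prems by (rule prob_space_kernel)
  have "(\<integral>\<^sup>+y. indicator G y * stay_prob K G n y \<partial>K x) \<le> (\<integral>\<^sup>+y. 1 \<partial>K x)"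
    using Suc by (intro nn_integral_mono) (auto simp: space_kernel[OF K] indicator_def)
  then show ?case by (simp add: emeasure_space_1)
qed simp

text \<open>The Markov property at time \<open>n\<close>: whatever state is reached then, staying in
  \<open>G\<close> for \<open>N\<close> further steps costs a factor of at most \<open>d\<close>.
  Taking \<open>n\<close> to be a multiple of \<open>N\<close> yields geometric decay.\<close>

lemma stay_prob_add_le:
  assumes "\<And>x. x \<in> space M \<Longrightarrow> stay_prob K G N x \<le> d" "x \<in> space M"
  shows "stay_prob K G (n + N) x \<le> d * stay_prob K G n x"
  using assms(2)
proof (induction n arbitrary: x)
  case (Suc n)
  note [measurable_cong] = sets_kernel[OF K Suc.prems]
  have "(\<integral>\<^sup>+y. indicator G y * stay_prob K G (n + N) y \<partial>K x)
      \<le> (\<integral>\<^sup>+y. d * (indicator G y * stay_prob K G n y) \<partial>K x)"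
    using Suc by (intro nn_integral_mono) (auto simp: space_kernel[OF K] indicator_def)
  then show ?case by (simp add: nn_integral_cmult)
qed (use assms(1) in simp)

section \<open>Stay probabilities as integrals over path space\<close>

text \<open>The factor \<open>stay_prob K G m (\<omega> n)\<close> makes the induction on
  \<open>n\<close> close: integrating out the last coordinate replaces \<open>m\<close> by
  \<open>Suc m\<close> and shortens the product by one factor.\<close>

lemma nn_integral_Ionescu_Tulcea_stay:
  assumes x: "x \<in> space M"
  shows "(\<integral>\<^sup>+\<omega>. (\<Prod>i\<le>n. indicator G (\<omega> i)) * stay_prob K G m (\<omega> n)
            \<partial>Ionescu_Tulcea.C (chain_kernel M K x) (\<lambda>_. M) 0 (Suc n) (\<lambda>_. undefined))
         = indicator G x * stay_prob K G (n + m) x"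
proof -
  interpret IT: Ionescu_Tulcea "chain_kernel M K x" "\<lambda>_. M"
    using K x by (rule Ionescu_Tulcea_chain_kernel)
  have u: "(\<lambda>_. undefined) \<in> space (PiM {0..<0::nat} (\<lambda>_. M))"
    by (simp add: space_PiM)
  let ?f = "\<lambda>n m \<omega>. (\<Prod>i\<le>n. indicator G (\<omega> i)) * stay_prob K G m (\<omega> n) :: ennreal"
  have f[measurable]: "?f n m \<in> borel_measurable (PiM {0..<Suc n} (\<lambda>_. M))" for n m
    by measurable
  \<comment> \<open>The law of coordinates \<open>0, ..., n\<close> is the law of the first
    \<open>n\<close> coordinates followed by one kernel step, which is isolated as the inner
    integral.\<close>
  have int: "(\<integral>\<^sup>+\<omega>. ?f n m \<omega> \<partial>IT.C 0 (Suc n) (\<lambda>_. undefined)) =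
      (\<integral>\<^sup>+\<omega>. \<integral>\<^sup>+y. ?f n m (fun_upd \<omega> n y) \<partial>chain_kernel M K x n \<omega> \<partial>IT.C 0 n (\<lambda>_. undefined))" for n m
  proof -
    have "(\<integral>\<^sup>+\<omega>. ?f n m \<omega> \<partial>IT.C 0 (Suc n) (\<lambda>_. undefined)) =
      (\<integral>\<^sup>+\<omega>. \<integral>\<^sup>+\<omega>'. ?f n m \<omega>' \<partial>IT.eP n \<omega> \<partial>IT.C 0 n (\<lambda>_. undefined))"
      using IT.measurable_eP[of n] unfolding IT.C.simps add_0
      by (intro nn_integral_bind[OF f]) (simp add: measurable_cong_sets[OF IT.sets_C[OF u] refl])
    also have "\<dots> = (\<integral>\<^sup>+\<omega>. \<integral>\<^sup>+y. ?f n m (fun_upd \<omega> n y) \<partial>chain_kernel M K x n \<omega> \<partial>IT.C 0 n (\<lambda>_. undefined))"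
      by (intro nn_integral_cong IT.nn_integral_eP[OF _ f]) (simp add: IT.space_C[OF u])
    finally show ?thesis .
  qed
  show ?thesis
  proof (induction n arbitrary: m)
    case 0
    show ?case
      unfolding int using x by (simp add: chain_kernel_def nn_integral_return space_PiM sets_PiM_empty)
  next
    case (Suc n)
    have "(\<integral>\<^sup>+y. ?f (Suc n) m (fun_upd \<omega> (Suc n) y) \<partial>chain_kernel M K x (Suc n) \<omega>) = ?f n (Suc m) \<omega>"
      if "\<omega> \<in> space (IT.C 0 (Suc n) (\<lambda>_. undefined))" for \<omega>
    proof -
      have w: "\<omega> n \<in> space M"
        using that unfolding IT.space_C[OF u] by (auto simp: space_PiM PiE_iff)
      note [measurable_cong] = sets_kernel[OF K w]
      have "(\<Prod>i\<le>n. indicator G ((fun_upd \<omega> (Suc n) y) i)) = (\<Prod>i\<le>n. indicator G (\<omega> i) :: ennreal)" for y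
        by (intro prod.cong) auto
      then show ?thesis
        by (simp add: chain_kernel_def mult.assoc nn_integral_cmult del: fun_upd_apply)
           (simp add: nn_integral_cmult)
    qed
    then show ?case
      unfolding int by (subst nn_integral_cong, assumption) (use Suc[of "Suc m"] in simp)
  qed
qed

text \<open>The integrand depends on coordinates \<open>0, ..., n\<close> only, so the projective
  limit may be replaced by its finite-dimensional marginal; the previous lemma with
  \<open>m = 0\<close> then applies.\<close>

lemma nn_integral_chain_law_stay:
  assumes x: "x \<in> space M"
  shows "(\<integral>\<^sup>+\<omega>. (\<Prod>i\<le>n. indicator G (\<omega> i)) \<partial>chain_law M K x) = indicator G x * stay_prob K G n x"
proof -
  interpret IT: Ionescu_Tulcea "chain_kernel M K x" "\<lambda>_. M"
    using K x by (rule Ionescu_Tulcea_chain_kernel)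
  let ?J = "{0..<Suc n}"
  let ?C = "IT.C 0 (Suc n) (\<lambda>_. undefined)"
  let ?f = "\<lambda>\<omega>. \<Prod>i\<le>n. indicator G (\<omega> i) :: ennreal"
  have f: "?f \<in> borel_measurable (PiM ?J (\<lambda>_. M))" by measurable
  \<comment> \<open>The marginal \<open>CI ?J\<close> is built by running the kernels up to
    \<open>up_to ?J\<close> and restricting to \<open>?J\<close>; this identifies it with a
    restriction of \<open>?C\<close>.\<close>
  have up: "IT.up_to ?J = Suc n"
    using IT.up_to_less[of ?J n] IT.up_to_iff[of ?J "Suc n"] by fastforce
  have sC: "sets ?C = sets (PiM ?J (\<lambda>_. M))"
    using IT.sets_C[of "\<lambda>_. undefined" 0 "Suc n"] by (simp add: space_PiM)
  have r: "(\<lambda>\<omega>. restrict \<omega> ?J) \<in> IT.PF.lim \<rightarrow>\<^sub>M PiM ?J (\<lambda>_. M)"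
    "(\<lambda>\<omega>. restrict \<omega> ?J) \<in> ?C \<rightarrow>\<^sub>M PiM ?J (\<lambda>_. M)"
    unfolding measurable_cong_sets[OF IT.PF.sets_lim refl] measurable_cong_sets[OF sC refl]
    by (auto intro!: measurable_restrict_subset)
  have f_restrict: "?f (restrict \<omega> ?J) = ?f \<omega>" for \<omega>
    by (intro prod.cong) auto
  have "(\<integral>\<^sup>+\<omega>. ?f \<omega> \<partial>IT.PF.lim) = (\<integral>\<^sup>+\<omega>. ?f \<omega> \<partial>distr IT.PF.lim (PiM ?J (\<lambda>_. M)) (\<lambda>\<omega>. restrict \<omega> ?J))"
    by (subst nn_integral_distr[OF r(1)]) (use f in \<open>simp_all only: measurable_distr_eq1 f_restrict\<close>)
  also have "\<dots> = (\<integral>\<^sup>+\<omega>. ?f \<omega> \<partial>distr ?C (PiM ?J (\<lambda>_. M)) (\<lambda>\<omega>. restrict \<omega> ?J))"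
    by (simp only: IT.distr_lim finite_atLeastLessThan) (simp only: IT.CI_def up)
  also have "\<dots> = (\<integral>\<^sup>+\<omega>. ?f \<omega> \<partial>?C)"
    by (subst nn_integral_distr[OF r(2)]) (use f in \<open>simp_all only: measurable_distr_eq1 f_restrict\<close>)
  also have "\<dots> = indicator G x * stay_prob K G n x"
    using nn_integral_Ionescu_Tulcea_stay[OF x, of n 0] by simp
  finally show ?thesis by (simp add: chain_law_def)
qed

end

lemma mean_hitting_time_eq_suminf:
  assumes K: "transition_prob M K" and H: "H \<in> sets M" and x: "x \<in> space M"
  shows "mean_hitting_time M K H x =
    (\<Sum>n. indicator (space M - H) x * stay_prob K (space M - H) n x)"
proof -
  interpret IT: Ionescu_Tulcea "chain_kernel M K x" "\<lambda>_. M"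
    using K x by (rule Ionescu_Tulcea_chain_kernel)
  have sets_law: "sets (chain_law M K x) = sets (PiM UNIV (\<lambda>_. M))"
    by (simp add: chain_law_def)
  let ?G = "space M - H"
  have G: "?G \<in> sets M" using H by auto
  have "mean_hitting_time M K H x = (\<integral>\<^sup>+\<omega>. (\<Sum>n. \<Prod>i\<le>n. indicator ?G (\<omega> i)) \<partial>chain_law M K x)"
    unfolding mean_hitting_time_def
  proof (rule nn_integral_cong)
    fix \<omega> assume "\<omega> \<in> space (chain_law M K x)"
    then have "\<omega> i \<in> space M" for i
      unfolding sets_eq_imp_space_eq[OF sets_law] by (auto simp: space_PiM)
    then show "hitting_time H \<omega> = (\<Sum>n. \<Prod>i\<le>n. indicator ?G (\<omega> i))"
      unfolding hitting_time_eq_suminf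
      by (intro suminf_cong prod.cong) (auto simp: indicator_def)
  qed
  also have "\<dots> = (\<Sum>n. \<integral>\<^sup>+\<omega>. (\<Prod>i\<le>n. indicator ?G (\<omega> i)) \<partial>chain_law M K x)"
  proof (rule nn_integral_suminf)
    note [measurable] = G
    show "(\<lambda>\<omega>. \<Prod>i\<le>n. indicator ?G (\<omega> i) :: ennreal) \<in> borel_measurable (chain_law M K x)" for n
      unfolding measurable_cong_sets[OF sets_law refl] by measurable
  qed
  also have "\<dots> = (\<Sum>n. indicator ?G x * stay_prob K ?G n x)"
    by (simp only: nn_integral_chain_law_stay[OF K G x])
  finally show ?thesis .
qed

section \<open>Integration against the restart kernel\<close>

text \<open>The kernel is given by its values on sets, so the mixture formula is extended from
  indicators to all nonnegative functions by linearity and monotone convergence.\<close>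

lemma nn_integral_restart_kernel:
  assumes \<nu>: "sets \<nu> = sets M" and P: "transition_prob M P" and x: "x \<in> space M"
    and f: "f \<in> borel_measurable M"
  shows "(\<integral>\<^sup>+y. f y \<partial>restart_kernel M p \<nu> P x) =
    ennreal p * (\<integral>\<^sup>+y. f y \<partial>\<nu>) + ennreal (1 - p) * (\<integral>\<^sup>+y. f y \<partial>P x)"
proof -
  note [measurable_cong] = \<nu> sets_kernel[OF P x] sets_restart_kernel[of M p \<nu> P x]
  note space = sets_eq_imp_space_eq[OF \<nu>] space_kernel[OF P x]
  from f show ?thesis
  proof (induction rule: borel_measurable_induct)
    case (cong f g)
    then show ?case
      using space by (simp cong: nn_integral_cong_simp)
  next
    case (set A)
    then show ?case
      using emeasure_restart_kernel[OF \<nu> P x] \<nu> sets_kernel[OF P x] by simp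
  next
    case (mult u c)
    then show ?case by (simp add: nn_integral_cmult algebra_simps)
  next
    case (add u v)
    then show ?case by (simp add: nn_integral_add algebra_simps)
  next
    case (seq U)
    note [measurable] = seq(1)
    have int: "(\<integral>\<^sup>+y. (SUP i. U i y) \<partial>N) = (SUP i. \<integral>\<^sup>+y. U i y \<partial>N)" if "sets N = sets M" for N
      using seq that
      by (intro nn_integral_monotone_convergence_SUP) (auto simp: measurable_cong_sets[OF that refl])
    have mono: "incseq (\<lambda>i. \<integral>\<^sup>+y. U i y \<partial>N)" for N
      using seq by (auto intro!: incseq_SucI nn_integral_mono simp: incseq_Suc_iff le_fun_def)
    show ?case
      unfolding SUP_apply
      by (simp add: int \<nu> sets_kernel[OF P x] seq SUP_mult_left_ennreal
          ennreal_SUP_add mono incseq_def mult_left_mono monoD[OF mono])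
  qed
qed

section \<open>Null sets of an invariant measure\<close>

text \<open>If \<open>N\<close> is \<open>q\<close>-null, invariance says that the nonnegative
  function \<open>emeasure (K x) N\<close> has \<open>q\<close>-integral 0, so it vanishes almost
  everywhere.\<close>

lemma AE_AE_invariant:
  assumes K: "transition_prob M K" and q: "invariant_prob_measure M K q" and Q: "AE y in q. Q y"
  shows "AE x in q. AE y in K x. Q y"
proof -
  have sq: "sets q = sets M"
    and inv: "\<And>A. A \<in> sets M \<Longrightarrow> emeasure q A = (\<integral>\<^sup>+x. emeasure (K x) A \<partial>q)"
    using q by (auto simp: invariant_prob_measure_def)
  obtain N where N: "{x \<in> space q. \<not> Q x} \<subseteq> N" "emeasure q N = 0" "N \<in> sets q"
    using Q by (rule AE_E)
  have "(\<lambda>x. emeasure (K x) N) \<in> borel_measurable M"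
    using N(3) sq measurable_emeasure_kernel[OF measurable_prob_algebraD[OF K]] by simp
  then have "AE x in q. emeasure (K x) N = 0"
    using inv[of N] N sq by (simp add: nn_integral_0_iff_AE measurable_cong_sets[OF sq refl])
  then show ?thesis
  proof (rule AE_mp[OF _ AE_I2[OF impI]])
    fix x assume x: "x \<in> space q" and 0: "emeasure (K x) N = 0"
    then have xM: "x \<in> space M" using sets_eq_imp_space_eq[OF sq] by simp
    show "AE y in K x. Q y"
      using 0 N sq sets_kernel[OF K xM] space_kernel[OF K xM] sets_eq_imp_space_eq[OF sq]
      by (intro AE_I[of _ _ N]) auto
  qed
qed

lemma AE_mean_hitting_time_eq_top:
  assumes K: "transition_prob M K" and H: "H \<in> sets M"
    and q: "invariant_prob_measure M K q" and q_H: "emeasure q H = 0"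
  shows "AE x in q. mean_hitting_time M K H x = \<top>"
proof -
  let ?G = "space M - H"
  have sq: "sets q = sets M" and sp: "space q = space M"
    using q sets_eq_imp_space_eq by (auto simp: invariant_prob_measure_def)
  have G: "AE x in q. x \<in> ?G"
    using q_H H sq sp by (intro AE_I[of _ _ H]) auto
  have stay: "AE x in q. stay_prob K ?G n x = 1" for n
  proof (induction n)
    case (Suc n)
    have "AE x in q. AE y in K x. y \<in> ?G \<and> stay_prob K ?G n y = 1"
      using G Suc by (intro AE_AE_invariant[OF K q]) auto
    then show ?case
    proof (rule AE_mp[OF _ AE_I2[OF impI]])
      fix x assume x: "x \<in> space q" and "AE y in K x. y \<in> ?G \<and> stay_prob K ?G n y = 1"
      then have "(\<integral>\<^sup>+y. indicator ?G y * stay_prob K ?G n y \<partial>K x) = (\<integral>\<^sup>+y. 1 \<partial>K x)"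
        by (intro nn_integral_cong_AE) (auto elim: AE_mp)
      then show "stay_prob K ?G (Suc n) x = 1"
        using prob_space.emeasure_space_1[OF prob_space_kernel[OF K]] x sp by simp
    qed
  qed simp
  have "AE x in q. \<forall>n. stay_prob K ?G n x = 1"
    using stay by (simp add: AE_all_countable)
  with G show ?thesis
  proof eventually_elim
    case (elim x)
    then show ?case
      using mean_hitting_time_eq_suminf[OF K H, of x] by (simp add: suminf_one_ennreal)
  qed
qed

text \<open>Mass balance: in one step \<open>A\<close> keeps its mass and gains at least the
  fraction \<open>p\<close> of the mass outside, while invariance leaves its mass unchanged. As
  \<open>q A\<close> is finite it cancels, so there is no mass outside.\<close>

lemma invariant_absorbing_full:
  assumes K: "transition_prob M K" and q: "invariant_prob_measure M K q"
    and A: "A \<in> sets M" and absorbing: "\<And>x. x \<in> A \<Longrightarrow> emeasure (K x) A = 1"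
    and minor: "\<And>x. x \<in> space M \<Longrightarrow> ennreal p \<le> emeasure (K x) A" and p: "0 < p"
  shows "emeasure q (space M - A) = 0"
proof -
  interpret q: prob_space q using q by (simp add: invariant_prob_measure_def)
  have sq: "sets q = sets M" and sp: "space q = space M"
    and inv: "\<And>A. A \<in> sets M \<Longrightarrow> emeasure q A = (\<integral>\<^sup>+x. emeasure (K x) A \<partial>q)"
    using q sets_eq_imp_space_eq by (auto simp: invariant_prob_measure_def)
  have [measurable]: "A \<in> sets q" using A sq by simp
  have "emeasure q A + ennreal p * emeasure q (space q - A)
      = (\<integral>\<^sup>+x. indicator A x + ennreal p * indicator (space q - A) x \<partial>q)"
    by (simp add: nn_integral_add nn_integral_cmult)
  also have "\<dots> \<le> (\<integral>\<^sup>+x. emeasure (K x) A \<partial>q)"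
    using absorbing minor sp by (intro nn_integral_mono) (auto simp: indicator_def)
  also have "\<dots> = emeasure q A" using inv A by simp
  finally have "ennreal p * emeasure q (space q - A) = 0"
    using ennreal_add_left_cancel_le[of "emeasure q A" _ 0] q.emeasure_finite[of A] by simp
  then show ?thesis using p sp by simp
qed

section \<open>Uniform bound on the mean hitting time\<close>

lemma restart_bounded_mean_hitting_time:
  assumes \<nu>: "prob_space \<nu>" "sets \<nu> = sets M" and P: "transition_prob M P" and p: "0 < p" "p < 1"
    and H: "H \<in> sets M"
    and q: "invariant_prob_measure M (restart_kernel M p \<nu> P) q" and q_H: "emeasure q H > 0"
  shows "\<exists>c. \<forall>x\<in>space M. mean_hitting_time M (restart_kernel M p \<nu> P) H x \<le> ennreal c"
proof -
  define K where "K = restart_kernel M p \<nu> P"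
  define G where "G = space M - H"
  have K: "transition_prob M K"
    unfolding K_def by (rule transition_prob_restart_kernel[OF \<nu> P p])
  have G[measurable]: "G \<in> sets M" using H by (auto simp: G_def)
  note [measurable] = measurable_stay_prob[OF K G]
  note [measurable_cong] = \<nu>(2)
  interpret \<nu>: prob_space \<nu> by fact
  have sp_\<nu>: "space \<nu> = space M" using sets_eq_imp_space_eq[OF \<nu>(2)] .
  have le_1: "indicator G y * stay_prob K G n y \<le> 1" if "y \<in> space M" for n y
    using stay_prob_le_1[OF K G that] by (simp add: indicator_def)
  \<comment> \<open>The probability that the chain with initial law \<nu> is in \<open>G\<close> at
    times \<open>0, ..., n\<close>.\<close>
  define a where "a n = (\<integral>\<^sup>+y. indicator G y * stay_prob K G n y \<partial>\<nu>)" for n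
  have a_le: "a n \<le> 1" for n
    using nn_integral_mono[of \<nu> "\<lambda>y. indicator G y * stay_prob K G n y" "\<lambda>_. 1"] le_1 \<nu>.emeasure_space_1
    by (simp add: a_def sp_\<nu>)
  have "\<exists>n. a n < 1"
  proof (rule ccontr)
    assume "\<not> (\<exists>n. a n < 1)"
    then have a: "a n = 1" for n using a_le[of n] by (auto simp: not_less intro: antisym)
    \<comment> \<open>A function bounded by 1 whose integral under a probability measure is 1 must
      equal 1 almost everywhere.\<close>
    have AE_1: "AE y in N. indicator G y * stay_prob K G n y = (1::ennreal)"
      if N: "prob_space N" "sets N = sets M" "(\<integral>\<^sup>+y. indicator G y * stay_prob K G n y \<partial>N) = 1" for N n
    proof -
      interpret N: prob_space N by fact
      note [measurable_cong] = N(2)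
      have sp: "space N = space M" using sets_eq_imp_space_eq[OF N(2)] .
      let ?f = "\<lambda>y. indicator G y * stay_prob K G n y"
      have "(\<integral>\<^sup>+y. 1 - ?f y \<partial>N) = (\<integral>\<^sup>+y. 1 \<partial>N) - (\<integral>\<^sup>+y. ?f y \<partial>N)"
        using N(3) le_1 sp by (intro nn_integral_diff) auto
      also have "\<dots> = 0" using N(3) by (simp add: N.emeasure_space_1)
      finally have "AE y in N. 1 - ?f y = 0"
        by (subst (asm) nn_integral_0_iff_AE) auto
      then show ?thesis
        by (rule AE_mp) (auto intro!: AE_I2 antisym le_1 simp: sp diff_eq_0_iff_ennreal)
    qed
    \<comment> \<open>The starting points from which \<open>H\<close> is almost surely never
      visited, time 0 included.\<close>
    define A where "A = {y \<in> space M. \<forall>n. indicator G y * stay_prob K G n y = (1::ennreal)}"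
    have A[measurable]: "A \<in> sets M" unfolding A_def by measurable
    have full: "emeasure N A = 1"
      if N: "prob_space N" "sets N = sets M" "\<And>n. (\<integral>\<^sup>+y. indicator G y * stay_prob K G n y \<partial>N) = 1" for N
    proof -
      interpret N: prob_space N by fact
      have "AE y in N. \<forall>n. indicator G y * stay_prob K G n y = (1::ennreal)"
        unfolding AE_all_countable using AE_1[OF N] by blast
      then have "AE y in N. y \<in> A"
        using sets_eq_imp_space_eq[OF N(2)] by (auto simp: A_def)
      then show ?thesis using A N(2) by (intro N.emeasure_eq_1_AE) auto
    qed
    have "emeasure q (space M - A) = 0"
    proof (rule invariant_absorbing_full[OF K _ A _ _ p(1)])
      show "invariant_prob_measure M K q" using q by (simp add: K_def)
    next
      fix x assume x: "x \<in> A"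
      then have xM: "x \<in> space M" and s: "stay_prob K G n x = 1" for n
        by (cases "x \<in> G"; auto simp: A_def)+
      \<comment> \<open>By its recursion, \<open>stay_prob K G (Suc n) x = 1\<close> is exactly the
        integral condition of \<open>full\<close> for the measure \<open>K x\<close>.\<close>
      show "emeasure (K x) A = 1"
        using s[of "Suc n" for n] by (intro full prob_space_kernel[OF K xM] sets_kernel[OF K xM]) simp
    next
      fix x assume x: "x \<in> space M"
      have "emeasure \<nu> A = 1" using a \<nu> by (intro full) (auto simp: a_def)
      then show "ennreal p \<le> emeasure (K x) A"
        unfolding K_def emeasure_restart_kernel[OF \<nu>(2) P x A] by simp
    qed
    moreover have "emeasure q H \<le> emeasure q (space M - A)"
      using q H A sets.sets_into_space[OF H]
      by (intro emeasure_mono) (auto simp: invariant_prob_measure_def A_def G_def indicator_def)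
    ultimately show False using q_H by simp
  qed
  then obtain n where n: "a n < 1" by blast
  \<comment> \<open>With weight \<open>p\<close> the first step restarts from \<nu> and then avoids
    \<open>H\<close> with probability \<open>a n\<close>; the other branch is bounded by 1. The
    restart itself takes a step, hence the time \<open>Suc n\<close> below.\<close>
  define d where "d = p * enn2real (a n) + (1 - p)"
  have an: "a n = ennreal (enn2real (a n))"
    by (intro ennreal_enn2real[symmetric] less_trans[OF n]) simp
  have "enn2real (a n) < 1" using n by (subst (asm) an) (simp add: ennreal_less_one_iff)
  then have d: "0 \<le> d" "d < 1" using p by (auto simp: d_def)
  have stay_d: "stay_prob K G (Suc n) x \<le> ennreal d" if x: "x \<in> space M" for x
  proof -
    interpret Px: prob_space "P x" using P x by (rule prob_space_kernel)
    have "(\<integral>\<^sup>+y. indicator G y * stay_prob K G n y \<partial>P x) \<le> (\<integral>\<^sup>+y. 1 \<partial>P x)"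
      using le_1 space_kernel[OF P x] by (intro nn_integral_mono) auto
    then have "(\<integral>\<^sup>+y. indicator G y * stay_prob K G n y \<partial>P x) \<le> 1"
      by (simp add: Px.emeasure_space_1)
    moreover have "stay_prob K G (Suc n) x = ennreal p * a n
        + ennreal (1 - p) * (\<integral>\<^sup>+y. indicator G y * stay_prob K G n y \<partial>P x)"
      using nn_integral_restart_kernel[OF \<nu>(2) P x, of "\<lambda>y. indicator G y * stay_prob K G n y" p]
      by (simp add: a_def flip: K_def)
    ultimately have "stay_prob K G (Suc n) x \<le> ennreal p * a n + ennreal (1 - p) * 1"
      by (simp only: add_left_mono mult_left_mono zero_le)
    also have "\<dots> = ennreal d"
      using p by (subst an) (simp add: d_def flip: ennreal_mult ennreal_plus)
    finally show ?thesis .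
  qed
  show ?thesis
  proof (intro exI ballI)
    fix x assume x: "x \<in> space M"
    have "mean_hitting_time M K H x = (\<Sum>k. indicator G x * stay_prob K G k x)"
      unfolding G_def by (rule mean_hitting_time_eq_suminf[OF K H x])
    also have "\<dots> \<le> (\<Sum>k. stay_prob K G k x)"
      by (intro suminf_le summableI) (auto simp: indicator_def)
    also have "\<dots> \<le> ennreal (real (Suc n) / (1 - d))"
      using stay_prob_le_1[OF K G x] stay_prob_add_le[OF K G stay_d x] d
      by (intro suminf_ennreal_le_of_shift_contraction) auto
    finally show "mean_hitting_time M (restart_kernel M p \<nu> P) H x \<le> ennreal (real (Suc n) / (1 - d))"
      by (simp add: K_def)
  qed
qed

section \<open>The cycle of implications from (a) to (d), (b), (c) and back to (a)\<close>

theorem theorem2p2: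
  fixes E H :: "'a::polish_space set"
    and P :: "'a \<Rightarrow> 'a measure"
    and \<nu> q :: "'a measure"
    and p :: real
    and Pt :: "'a \<Rightarrow> 'a measure"
    and V :: "'a \<Rightarrow> ennreal"
  assumes "E \<noteq> {}" and "E \<in> sets borel" and "locally compact E"
    and "transition_prob (borel_on E) P"
    and "prob_space \<nu>" and "sets \<nu> = sets (borel_on E)"
    and "0 < p" and "p < 1"
    and "H \<in> sets (borel_on E)"
    and "Pt = restart_kernel (borel_on E) p \<nu> P"
    and "invariant_prob_measure (borel_on E) Pt q"
    and "V = mean_hitting_time (borel_on E) Pt H"
  shows "(emeasure q H > 0 \<longleftrightarrow> (\<forall>x\<in>E. V x < \<infinity>))
       \<and> ((\<forall>x\<in>E. V x < \<infinity>) \<longleftrightarrow> (AE x in q. V x < \<infinity>))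
       \<and> ((AE x in q. V x < \<infinity>) \<longleftrightarrow> (SUP x\<in>E. V x) < \<infinity>)"
proof -
  let ?M = "borel_on E"
  have sp: "space ?M = E" by (simp add: space_restrict_space)
  have Pt: "transition_prob ?M Pt"
    unfolding assms(10) using assms by (intro transition_prob_restart_kernel)
  interpret q: prob_space q using assms(11) by (simp add: invariant_prob_measure_def)
  have sq: "space q = E"
    using assms(11) sets_eq_imp_space_eq sp by (auto simp: invariant_prob_measure_def)
  have ad: "(SUP x\<in>E. V x) < \<infinity>" if "emeasure q H > 0"
  proof -
    obtain c where "\<forall>x\<in>space ?M. mean_hitting_time ?M Pt H x \<le> ennreal c"
      using restart_bounded_mean_hitting_time[OF assms(5,6,4,7,8,9)] assms(10,11) \<open>emeasure q H > 0\<close>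
      by blast
    then have "(SUP x\<in>E. V x) \<le> ennreal c"
      unfolding assms(12) sp by (intro SUP_least) auto
    then show ?thesis
      by (rule le_less_trans) simp
  qed
  have db: "\<forall>x\<in>E. V x < \<infinity>" if "(SUP x\<in>E. V x) < \<infinity>"
    using that by (meson SUP_upper order_le_less_trans)
  have bc: "AE x in q. V x < \<infinity>" if "\<forall>x\<in>E. V x < \<infinity>"
    using that sq by (intro AE_I2) auto
  have ca: "emeasure q H > 0" if c: "AE x in q. V x < \<infinity>"
  proof (rule ccontr)
    \<comment> \<open>If \<open>H\<close> is null, \<open>V\<close> is infinite almost everywhere,
      which is incompatible with (c) because \<open>q\<close> has total mass 1.\<close>
    assume "\<not> emeasure q H > 0"
    then have "AE x in q. V x = \<top>"
      unfolding assms(12) using AE_mean_hitting_time_eq_top[OF Pt assms(9,11)]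
      by (simp add: zero_less_iff_neq_zero)
    with c have "AE x in q. False" by eventually_elim simp
    then show False using q.not_empty q.emeasure_space_1 by simp
  qed
  from ad db bc ca show ?thesis by blast
qed

end
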